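(* The topological entropy of the subshift $X_{\mathscr{B}}$ is given by $$h_{\mathrm{top}}(X_{\mathscr{B}})=\prod_{k=1}^\infty\left(1-\frac1{b_k}\right).$$
   Context: $\mathbb{N}^*=\{1,2,3,\ldots\}$. $\mathscr{B}=\{b_k:k\ge1\}\subset\{2,3,4,\ldots\}$ is a given infinite set of pairwise relatively prime integers with $\sum_{k\ge1}1/b_k<\infty$. For $A\subset\mathbb{N}^*$ and $b\ge1$, $t(A,b)$ is the number of residue classes modulo $b$ containing an element of $A$. $A$ is $\mathscr{B}$-admissible if $t(A,b_k)<b_k$ for all $k\ge1$. A sequence $x\in\{0,1\}^{\mathbb{N}^*}$ (respectively a word $w_1\ldots w_n\in\{0,1\}^n$) is $\mathscr{B}$-admissible if the set of indices at which it takes the value $1$ is $\mathscr{B}$-admissible. $X_{\mathscr{B}}\subset\{0,1\}^{\mathbb{N}^*}$ is the set of $\mathscr{B}$-admissible sequences; it is closed and invariant under the shift $(Sx)_n=x_{n+1}$. Topological entropy is taken with logarithms in base $2$: $h_{\mathrm{top}}(X_{\mathscr{B}})=\lim_{n\to\infty}\frac1n\log_2\gamma(n)$, where $\gamma(n)$ is the number of words of length $n$ appearing in $X_{\mathscr{B}}$, i.e. the number of $\mathscr{B}$-admissible words in $\{0,1\}^n$. *)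

theory Defs
  imports "HOL-Analysis.Analysis"
begin

text \<open>
  Infinite sequences are functions on the index set \<open>{1..}\<close>, words of length \<open>n\<close> are functions on
  \<open>{1..n}\<close>; both are extensional, so that distinct functions are distinct sequences or words.
\<close>

definition residue_count :: "nat set \<Rightarrow> nat \<Rightarrow> nat" where
  "residue_count A b = card ((\<lambda>a. a mod b) ` A)"

definition admissible_set :: "nat set \<Rightarrow> nat set \<Rightarrow> bool" where
  "admissible_set B A \<longleftrightarrow> (\<forall>b\<in>B. residue_count A b < b)"

definition admissible_shift :: "nat set \<Rightarrow> (nat \<Rightarrow> nat) set" where
  "admissible_shift B = {x \<in> {1..} \<rightarrow>\<^sub>E {0, 1}. admissible_set B {n \<in> {1..}. x n = 1}}"

text \<open>The word read off \<open>x\<close> at offset \<open>m\<close> is \<open>x\<^bsub>m+1\<^esub> \<dots> x\<^bsub>m+n\<^esub>\<close>.\<close>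

definition words :: "(nat \<Rightarrow> nat) set \<Rightarrow> nat \<Rightarrow> (nat \<Rightarrow> nat) set" where
  "words X n = {restrict (\<lambda>i. x (m + i)) {1..n} | x m. x \<in> X}"

definition entropy_seq :: "(nat \<Rightarrow> nat) set \<Rightarrow> nat \<Rightarrow> real" where
  "entropy_seq X n = log 2 (real (card (words X n))) / real n"

definition top_entropy :: "(nat \<Rightarrow> nat) set \<Rightarrow> real" where
  "top_entropy X = lim (entropy_seq X)"

end

(* The count of admissible words is squeezed between two bounds obtained by truncating to the
   first K moduli. If an admissible word misses the residue r_k modulo b_k, its support lies in the
   set of integers avoiding the classes r_1, ..., r_K, which by the Chinese remainder theorem has
   density prod_{k <= K} (1 - 1/b_k); there are finitely many choices of (r_1, ..., r_K).
   Conversely, every set of integers divisible by no b_k is admissible, and up to the density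
   sum_{k > K} 1/b_k such integers are counted by the same product. Finally let K tend to infinity. *)
theory Submission
  imports Defs "HOL-Number_Theory.Cong"
begin

section \<open>Admissible sets and words\<close>

text \<open>Residues modulo \<open>b\<close> lie in \<open>{..<b}\<close>, so having fewer than
  \<open>b\<close> of them amounts to missing one. The missed class \<open>r\<close> is the witness
  that subsets inherit and that translation moves.\<close>

lemma residue_count_less_iff:
  assumes "0 < b"
  shows "residue_count A b < b \<longleftrightarrow> (\<exists>r<b. \<forall>a\<in>A. a mod b \<noteq> r)"
proof -
  let ?R = "(\<lambda>a. a mod b) ` A"
  have sub: "?R \<subseteq> {..<b}" using assms by auto
  have "card ?R < b \<longleftrightarrow> ?R \<noteq> {..<b}"
    using psubset_card_mono[of "{..<b}" ?R] sub by auto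
  also have "\<dots> \<longleftrightarrow> (\<exists>r<b. \<forall>a\<in>A. a mod b \<noteq> r)"
    using sub by (metis (no_types, lifting) image_iff lessThan_iff subsetI subset_antisym)
  finally show ?thesis unfolding residue_count_def .
qed

lemma admissible_set_mono:
  assumes "admissible_set B A" "A' \<subseteq> A" "0 \<notin> B"
  shows "admissible_set B A'"
  unfolding admissible_set_def
proof
  fix b assume "b \<in> B"
  with assms have b: "0 < b" "residue_count A b < b"
    by (auto simp: admissible_set_def intro: gr0I)
  then show "residue_count A' b < b"
    using assms(2) by (meson residue_count_less_iff subsetD)
qed

text \<open>Translation permutes the residue classes: where \<open>A\<close> misses
  \<open>r\<close>, its translate misses \<open>r - m\<close>.\<close>

lemma admissible_set_shift:
  assumes "admissible_set B A" "0 \<notin> B"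
  shows "admissible_set B {i. m + i \<in> A}"
  unfolding admissible_set_def
proof
  fix b assume "b \<in> B"
  with assms have b: "0 < b" "residue_count A b < b"
    by (auto simp: admissible_set_def intro: gr0I)
  then obtain r where r: "r < b" "\<And>a. a \<in> A \<Longrightarrow> a mod b \<noteq> r"
    using residue_count_less_iff by blast
  \<comment> \<open>The residue \<open>r - m\<close>, written without subtraction.\<close>
  define s where "s = (r + m * (b - 1)) mod b"
  have "i mod b \<noteq> s" if "m + i \<in> A" for i
  proof
    assume "i mod b = s"
    then have "(m + i) mod b = (m + (r + m * (b - 1))) mod b"
      unfolding s_def by (metis mod_add_right_eq)
    also have "m + (r + m * (b - 1)) = r + m * b"
      using b(1) by (cases b) auto
    finally have "(m + i) mod b = r" using r(1) by simp
    with r(2)[OF that] show False by simp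
  qed
  moreover have "s < b" using b by (simp add: s_def)
  ultimately show "residue_count {i. m + i \<in> A} b < b"
    using residue_count_less_iff[OF b(1)] by blast
qed

text \<open>Reading a word off a sequence translates the support and cuts it down, and both
  operations preserve admissibility. Conversely, padding an admissible word with zeros leaves its
  support unchanged and gives an admissible sequence.\<close>

lemma words_admissible_shift:
  assumes "0 \<notin> B"
  shows "words (admissible_shift B) n =
    {w \<in> {1..n} \<rightarrow>\<^sub>E {0, 1}. admissible_set B {i \<in> {1..n}. w i = 1}}"
proof (intro equalityI subsetI)
  fix w assume "w \<in> words (admissible_shift B) n"
  then obtain x m where x: "x \<in> {1..} \<rightarrow>\<^sub>E {0, 1}" "admissible_set B {n \<in> {1..}. x n = 1}"
    and w: "w = restrict (\<lambda>i. x (m + i)) {1..n}"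
    by (auto simp: words_def admissible_shift_def)
  have "w \<in> {1..n} \<rightarrow>\<^sub>E {0, 1}"
    unfolding w using x(1) by (intro restrict_PiE_iff[THEN iffD2] ballI PiE_mem[of x "{1..}"]) auto
  moreover have "admissible_set B {i \<in> {1..n}. w i = 1}"
    by (rule admissible_set_mono[OF admissible_set_shift[OF x(2) assms, of m] _ assms])
      (auto simp: w)
  ultimately show "w \<in> {w \<in> {1..n} \<rightarrow>\<^sub>E {0, 1}. admissible_set B {i \<in> {1..n}. w i = 1}}"
    by simp
next
  fix w :: "nat \<Rightarrow> nat"
  assume "w \<in> {w \<in> {1..n} \<rightarrow>\<^sub>E {0, 1}. admissible_set B {i \<in> {1..n}. w i = 1}}"
  then have w: "w \<in> {1..n} \<rightarrow>\<^sub>E {0, 1}" "admissible_set B {i \<in> {1..n}. w i = 1}"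
    by auto
  define x where "x = restrict (\<lambda>i. if i \<le> n then w i else 0) {1..}"
  have "{i \<in> {1..}. x i = 1} = {i \<in> {1..n}. w i = 1}"
    by (auto simp: x_def split: if_splits)
  moreover have "x \<in> {1..} \<rightarrow>\<^sub>E {0, 1}"
    unfolding x_def using w(1) by (intro restrict_PiE_iff[THEN iffD2] ballI) (auto dest!: PiE_mem)
  ultimately have "x \<in> admissible_shift B"
    using w(2) by (simp add: admissible_shift_def)
  moreover have "w = restrict (\<lambda>i. x (0 + i)) {1..n}"
  proof
    fix i
    show "w i = restrict (\<lambda>i. x (0 + i)) {1..n} i"
      using PiE_arb[OF w(1), of i] by (cases "i \<in> {1..n}") (auto simp: x_def)
  qed
  ultimately show "w \<in> words (admissible_shift B) n"
    unfolding words_def by blast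
qed

lemma card_words_admissible_shift:
  assumes "0 \<notin> B"
  shows "card (words (admissible_shift B) n) = card {A. A \<subseteq> {1..n} \<and> admissible_set B A}"
proof -
  define f where "f w = {i \<in> {1..n}. w i = 1}" for w :: "nat \<Rightarrow> nat"
  define g where "g A = restrict (\<lambda>i. if i \<in> A then 1 else 0 :: nat) {1..n}" for A
  define F where "F = ({1..n} \<rightarrow>\<^sub>E {0, 1} :: (nat \<Rightarrow> nat) set)"
  have W: "words (admissible_shift B) n = {w \<in> F. admissible_set B (f w)}"
    unfolding f_def F_def by (rule words_admissible_shift[OF assms])
  have fg: "f (g A) = A" if "A \<subseteq> {1..n}" for A
    using that by (auto simp: f_def g_def)
  \<comment> \<open>Equality of functions also concerns indices outside \<open>{1..n}\<close>, where
    extensionality makes both sides \<open>undefined\<close>.\<close>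
  have gf: "g (f w) = w" if "w \<in> F" for w
  proof
    fix i
    have w: "w \<in> {1..n} \<rightarrow>\<^sub>E {0, 1}" using that by (simp add: F_def)
    show "g (f w) i = w i"
      using PiE_mem[OF w, of i] PiE_arb[OF w, of i] by (cases "i \<in> {1..n}") (auto simp: f_def g_def)
  qed
  have "f w \<subseteq> {1..n}" for w
    by (auto simp: f_def)
  moreover have "g A \<in> F" for A
    by (auto simp: g_def F_def)
  ultimately have "bij_betw f (words (admissible_shift B) n) {A. A \<subseteq> {1..n} \<and> admissible_set B A}"
    unfolding W using fg gf by (intro bij_betw_byWitness[where f' = g]) auto
  then show ?thesis by (rule bij_betw_same_card)
qed

section \<open>Counting integers avoiding residue classes\<close>

text \<open>Chinese remainder theorem: over one period the vector of residues runs exactly once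
  through the box of all residue vectors, and avoiding \<open>r k\<close> leaves
  \<open>c k - 1\<close> values in coordinate \<open>k\<close>.\<close>

lemma card_avoid_residues_period:
  fixes c r :: "'i \<Rightarrow> nat"
  assumes "finite I" and r: "\<And>k. k \<in> I \<Longrightarrow> r k < c k"
    and cop: "\<And>j k. j \<in> I \<Longrightarrow> k \<in> I \<Longrightarrow> j \<noteq> k \<Longrightarrow> coprime (c j) (c k)"
  shows "card {a \<in> {s..<s + (\<Prod>k\<in>I. c k)}. \<forall>k\<in>I. a mod c k \<noteq> r k} = (\<Prod>k\<in>I. c k - 1)"
proof -
  let ?P = "\<Prod>k\<in>I. c k"
  let ?f = "\<lambda>a. \<lambda>k\<in>I. a mod c k"
  have inj: "inj_on ?f {s..<s + ?P}"
  proof (rule inj_onI)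
    fix x y assume xy: "x \<in> {s..<s + ?P}" "y \<in> {s..<s + ?P}" "?f x = ?f y"
    have "x mod c k = y mod c k" if "k \<in> I" for k
      using fun_cong[OF xy(3), of k] that by simp
    then have "[x = y] (mod ?P)"
      using cop by (intro cong_cong_prod_coprime_nat) (auto simp: cong_def)
    \<comment> \<open>The distance of \<open>x\<close> and \<open>y\<close> is a multiple of the
      period and smaller than it, hence zero.\<close>
    then have "?P dvd nat \<bar>int x - int y\<bar>"
      by (simp add: cong_altdef_nat')
    moreover have "nat \<bar>int x - int y\<bar> < ?P" using xy by auto
    ultimately have "nat \<bar>int x - int y\<bar> = 0"
      by (meson nat_dvd_not_less not_gr_zero)
    then show "x = y" by simp
  qed
  \<comment> \<open>Surjectivity comes from counting: the map is injective, and interval and box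
    both have \<open>?P\<close> elements.\<close>
  have "?f ` {s..<s + ?P} = (\<Pi>\<^sub>E k\<in>I. {..<c k})"
  proof (rule card_subset_eq)
    show "finite (\<Pi>\<^sub>E k\<in>I. {..<c k})" using assms(1) by (intro finite_PiE) auto
    show "?f ` {s..<s + ?P} \<subseteq> (\<Pi>\<^sub>E k\<in>I. {..<c k})"
      using r by (auto simp: gr_implies_not0 intro!: mod_less_divisor) (metis gr0I less_nat_zero_code)
    show "card (?f ` {s..<s + ?P}) = card (\<Pi>\<^sub>E k\<in>I. {..<c k})"
      using assms(1) by (simp add: card_image[OF inj] card_PiE)
  qed
  moreover have "?f ` {a \<in> {s..<s + ?P}. \<forall>k\<in>I. a mod c k \<noteq> r k}
      = {g \<in> ?f ` {s..<s + ?P}. \<forall>k\<in>I. g k \<noteq> r k}"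
    by auto
  ultimately have "?f ` {a \<in> {s..<s + ?P}. \<forall>k\<in>I. a mod c k \<noteq> r k}
      = {g \<in> (\<Pi>\<^sub>E k\<in>I. {..<c k}). \<forall>k\<in>I. g k \<noteq> r k}"
    by (simp only:)
  also have "\<dots> = (\<Pi>\<^sub>E k\<in>I. {..<c k} - {r k})"
    by (auto simp: PiE_iff extensional_def)
  finally have "card {a \<in> {s..<s + ?P}. \<forall>k\<in>I. a mod c k \<noteq> r k}
      = card (\<Pi>\<^sub>E k\<in>I. {..<c k} - {r k})"
    using card_image[OF inj_on_subset[OF inj]] by (metis (no_types, lifting) mem_Collect_eq subsetI)
  also have "\<dots> = (\<Prod>k\<in>I. c k - 1)"
    using assms(1) r by (simp add: card_PiE)
  finally show ?thesis .
qed

text \<open>The free start \<open>s\<close> of the one-period count lets it apply to the last of the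
  \<open>Suc m\<close> blocks.\<close>

lemma card_avoid_residues_periods:
  fixes c r :: "'i \<Rightarrow> nat"
  assumes "finite I" and "\<And>k. k \<in> I \<Longrightarrow> r k < c k"
    and "\<And>j k. j \<in> I \<Longrightarrow> k \<in> I \<Longrightarrow> j \<noteq> k \<Longrightarrow> coprime (c j) (c k)"
  shows "card {a \<in> {s..<s + m * (\<Prod>k\<in>I. c k)}. \<forall>k\<in>I. a mod c k \<noteq> r k} = m * (\<Prod>k\<in>I. c k - 1)"
proof (induction m)
  case 0
  then show ?case by simp
next
  case (Suc m)
  let ?P = "\<Prod>k\<in>I. c k" and ?ok = "\<lambda>a. \<forall>k\<in>I. a mod c k \<noteq> r k"
  have "{a \<in> {s..<s + Suc m * ?P}. ?ok a}
      = {a \<in> {s..<s + m * ?P}. ?ok a} \<union> {a \<in> {s + m * ?P..<(s + m * ?P) + ?P}. ?ok a}"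
    by auto
  moreover have "card ({a \<in> {s..<s + m * ?P}. ?ok a} \<union> {a \<in> {s + m * ?P..<(s + m * ?P) + ?P}. ?ok a})
      = card {a \<in> {s..<s + m * ?P}. ?ok a} + card {a \<in> {s + m * ?P..<(s + m * ?P) + ?P}. ?ok a}"
    by (rule card_Un_disjoint) auto
  ultimately show ?case
    using Suc.IH card_avoid_residues_period[of I r c "s + m * ?P"] assms by simp
qed

text \<open>Since \<open>n\<close> lies between consecutive multiples of the period, the count and
  its expected value lie between the same consecutive multiples of the number of survivors per
  period. The error is thus independent of \<open>n\<close> and \<open>r\<close>.\<close>

lemma card_avoid_residues_bounds:
  fixes c r :: "'i \<Rightarrow> nat"
  assumes fin: "finite I" and r: "\<And>k. k \<in> I \<Longrightarrow> r k < c k"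
    and cop: "\<And>j k. j \<in> I \<Longrightarrow> k \<in> I \<Longrightarrow> j \<noteq> k \<Longrightarrow> coprime (c j) (c k)"
  shows "\<bar>real (card {a \<in> {1..n}. \<forall>k\<in>I. a mod c k \<noteq> r k}) - real n * (\<Prod>k\<in>I. 1 - 1 / real (c k))\<bar>
    \<le> real (\<Prod>k\<in>I. c k - 1)"
proof -
  define P where "P = (\<Prod>k\<in>I. c k)"
  define Q where "Q = (\<Prod>k\<in>I. c k - 1)"
  define N where "N = card {a \<in> {1..n}. \<forall>k\<in>I. a mod c k \<noteq> r k}"
  have pos: "0 < c k" if "k \<in> I" for k using r[OF that] by simp
  then have "0 < P" unfolding P_def by (intro prod_pos) auto
  have density: "(\<Prod>k\<in>I. 1 - 1 / real (c k)) = real Q / real P"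
  proof -
    have "1 - 1 / real (c k) = real (c k - 1) / real (c k)" if "k \<in> I" for k
      using pos[OF that] by (simp add: field_simps of_nat_diff)
    then show ?thesis by (simp add: Q_def P_def prod_dividef cong: prod.cong)
  qed
  have periods: "card {a \<in> {1..<1 + m * P}. \<forall>k\<in>I. a mod c k \<noteq> r k} = m * Q" for m
    unfolding P_def Q_def using assms by (rule card_avoid_residues_periods)
  have low: "n div P * P \<le> n" by simp
  have up: "n < (n div P + 1) * P"
    using dividend_less_div_times[OF \<open>0 < P\<close>, of n] by (simp add: algebra_simps)
  have "(n div P) * Q \<le> N"
    unfolding N_def periods[symmetric] using le_trans[OF _ low] by (intro card_mono) (auto simp: less_Suc_eq_le)
  moreover have "N \<le> (n div P + 1) * Q"
    unfolding N_def periods[symmetric] using up by (intro card_mono) auto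
  ultimately have N: "real (n div P) * real Q \<le> real N" "real N \<le> (real (n div P) + 1) * real Q"
    by (metis of_nat_le_iff of_nat_mult, metis of_nat_le_iff of_nat_mult of_nat_add of_nat_1)
  have "real (n div P) \<le> real n / real P" "real n / real P \<le> real (n div P) + 1"
    using of_nat_mono[OF low, where 'a=real] of_nat_mono[OF less_imp_le[OF up], where 'a=real] \<open>0 < P\<close>
    by (auto simp: field_simps)
  then have "real (n div P) * real Q \<le> real n / real P * real Q"
    "real n / real P * real Q \<le> (real (n div P) + 1) * real Q"
    by (auto intro: mult_right_mono simp del: times_divide_eq_left)
  with N have "\<bar>real N - real n / real P * real Q\<bar> \<le> real Q"
    by (simp add: abs_le_iff algebra_simps)
  then show ?thesis unfolding density N_def Q_def[symmetric] by simp
qed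

section \<open>Multiples of the tail moduli\<close>

lemma card_multiples_le:
  fixes n d :: nat
  assumes "0 < d"
  shows "card {a \<in> {1..n}. d dvd a} \<le> n div d"
proof -
  have "{a \<in> {1..n}. d dvd a} \<subseteq> (*) d ` {1..n div d}"
  proof
    fix a assume "a \<in> {a \<in> {1..n}. d dvd a}"
    then obtain q where q: "a = d * q" "1 \<le> a" "a \<le> n" by auto
    then have "q = a div d" "0 < q" using assms by auto
    then have "q \<in> {1..n div d}" using q(3) by (simp add: div_le_mono Suc_leI)
    then show "a \<in> (*) d ` {1..n div d}" using q(1) by blast
  qed
  then have "card {a \<in> {1..n}. d dvd a} \<le> card {1..n div d}"
    by (rule surj_card_le[OF finite_atLeastAtMost])
  then show ?thesis by simp
qed

text \<open>Union bound over the moduli from index \<open>K\<close> on. It is linear in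
  \<open>n\<close>, with a coefficient that tends to 0 as \<open>K\<close> grows.\<close>

lemma card_tail_multiples_le:
  fixes c :: "nat \<Rightarrow> nat"
  assumes "inj c" and pos: "\<And>k. 0 < c k" and "summable (\<lambda>k. 1 / real (c k))"
  shows "real (card {a \<in> {1..n}. \<exists>k\<ge>K. c k dvd a}) \<le> real n * (\<Sum>k. 1 / real (c (k + K)))"
proof -
  \<comment> \<open>Only moduli up to \<open>n\<close> can divide a number in \<open>{1..n}\<close>;
    injectivity of \<open>c\<close> makes these finitely many.\<close>
  define F where "F = {k. c (k + K) \<le> n}"
  have inj: "inj (\<lambda>k. c (k + K))"
    using assms(1) by (intro injI) (metis injD add_right_cancel)
  have "finite F"
    using finite_vimageI[OF finite_atMost[of n] inj] by (simp add: F_def vimage_def)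
  have "{a \<in> {1..n}. \<exists>k\<ge>K. c k dvd a} \<subseteq> (\<Union>k\<in>F. {a \<in> {1..n}. c (k + K) dvd a})"
  proof
    fix a assume "a \<in> {a \<in> {1..n}. \<exists>k\<ge>K. c k dvd a}"
    then obtain k where a: "a \<in> {1..n}" "k \<ge> K" "c k dvd a" by blast
    then have "k - K \<in> F" "c ((k - K) + K) dvd a"
      by (auto simp: F_def dest: dvd_imp_le)
    with a(1) show "a \<in> (\<Union>k\<in>F. {a \<in> {1..n}. c (k + K) dvd a})" by blast
  qed
  then have "card {a \<in> {1..n}. \<exists>k\<ge>K. c k dvd a} \<le> card (\<Union>k\<in>F. {a \<in> {1..n}. c (k + K) dvd a})"
    using \<open>finite F\<close> by (intro card_mono) auto
  also have "\<dots> \<le> (\<Sum>k\<in>F. card {a \<in> {1..n}. c (k + K) dvd a})"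
    using \<open>finite F\<close> by (rule card_UN_le)
  also have "\<dots> \<le> (\<Sum>k\<in>F. n div c (k + K))"
    using pos by (intro sum_mono card_multiples_le)
  finally have "real (card {a \<in> {1..n}. \<exists>k\<ge>K. c k dvd a}) \<le> real (\<Sum>k\<in>F. n div c (k + K))"
    by (rule of_nat_mono)
  also have "\<dots> \<le> (\<Sum>k\<in>F. real n * (1 / real (c (k + K))))"
    unfolding of_nat_sum by (intro sum_mono) (use of_nat_div_le_of_nat in auto)
  also have "\<dots> = real n * (\<Sum>k\<in>F. 1 / real (c (k + K)))"
    by (simp add: sum_distrib_left)
  also have "\<dots> \<le> real n * (\<Sum>k. 1 / real (c (k + K)))"
    using \<open>finite F\<close> summable_ignore_initial_segment[OF assms(3), of K]
    by (intro mult_left_mono sum_le_suminf) auto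
  finally show ?thesis .
qed

section \<open>Bounds for the number of admissible sets\<close>

text \<open>The factor \<open>\<Prod>k\<in>I. c k\<close> counts the choices of one missed class per
  modulus; the exponent bounds the size of the sieved set uniformly in the choice.\<close>

lemma card_admissible_le:
  fixes c :: "'i \<Rightarrow> nat"
  assumes fin: "finite I" and pos: "\<And>k. k \<in> I \<Longrightarrow> 0 < c k" and "c ` I \<subseteq> B"
    and cop: "\<And>j k. j \<in> I \<Longrightarrow> k \<in> I \<Longrightarrow> j \<noteq> k \<Longrightarrow> coprime (c j) (c k)"
  shows "real (card {A. A \<subseteq> {1..n} \<and> admissible_set B A})
    \<le> real (\<Prod>k\<in>I. c k) * 2 powr (real n * (\<Prod>k\<in>I. 1 - 1 / real (c k)) + real (\<Prod>k\<in>I. c k - 1))"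
proof -
  let ?R = "\<Pi>\<^sub>E k\<in>I. {..<c k}"
  let ?E = "\<lambda>r. {a \<in> {1..n}. \<forall>k\<in>I. a mod c k \<noteq> r k}"
  let ?M = "2 powr (real n * (\<Prod>k\<in>I. 1 - 1 / real (c k)) + real (\<Prod>k\<in>I. c k - 1))"
  have "finite ?R" using fin by (intro finite_PiE) auto
  have "{A. A \<subseteq> {1..n} \<and> admissible_set B A} \<subseteq> (\<Union>r\<in>?R. Pow (?E r))"
  proof
    fix A assume "A \<in> {A. A \<subseteq> {1..n} \<and> admissible_set B A}"
    then have A: "A \<subseteq> {1..n}" "admissible_set B A" by auto
    have "\<forall>k\<in>I. \<exists>r<c k. \<forall>a\<in>A. a mod c k \<noteq> r"
    proof
      fix k assume "k \<in> I"
      then have "residue_count A (c k) < c k"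
        using A(2) assms(3) by (auto simp: admissible_set_def)
      then show "\<exists>r<c k. \<forall>a\<in>A. a mod c k \<noteq> r"
        using residue_count_less_iff[OF pos[OF \<open>k \<in> I\<close>]] by blast
    qed
    then obtain r where r: "\<And>k. k \<in> I \<Longrightarrow> r k < c k \<and> (\<forall>a\<in>A. a mod c k \<noteq> r k)"
      by metis
    \<comment> \<open>Restriction makes the choice of missed classes a member of the finite box, so
      that the union is finite.\<close>
    then have "restrict r I \<in> ?R" by auto
    moreover have "A \<in> Pow (?E (restrict r I))" using A(1) r by auto
    ultimately show "A \<in> (\<Union>r\<in>?R. Pow (?E r))" by blast
  qed
  then have "card {A. A \<subseteq> {1..n} \<and> admissible_set B A} \<le> card (\<Union>r\<in>?R. Pow (?E r))"
    using \<open>finite ?R\<close> by (intro card_mono) auto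
  also have "\<dots> \<le> (\<Sum>r\<in>?R. card (Pow (?E r)))"
    using \<open>finite ?R\<close> by (rule card_UN_le)
  finally have "real (card {A. A \<subseteq> {1..n} \<and> admissible_set B A}) \<le> (\<Sum>r\<in>?R. real (card (Pow (?E r))))"
    unfolding of_nat_sum[symmetric] by (rule of_nat_mono)
  also have "\<dots> \<le> (\<Sum>r\<in>?R. ?M)"
  proof (rule sum_mono)
    fix r assume "r \<in> ?R"
    then have "r k < c k" if "k \<in> I" for k using that by auto
    then have "real (card (?E r)) \<le> real n * (\<Prod>k\<in>I. 1 - 1 / real (c k)) + real (\<Prod>k\<in>I. c k - 1)"
      using card_avoid_residues_bounds[of I r c n] fin cop by (auto simp: abs_le_iff)
    then have "2 powr real (card (?E r)) \<le> ?M" by (rule powr_mono) simp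
    then show "real (card (Pow (?E r))) \<le> ?M"
      by (simp add: card_Pow powr_realpow)
  qed
  also have "\<dots> = real (\<Prod>k\<in>I. c k) * ?M"
    using fin by (simp add: card_PiE)
  finally show ?thesis .
qed

text \<open>A set of numbers divisible by no \<open>c k\<close> misses the class 0 modulo each of
  them, so every subset of \<open>?E\<close> is admissible.\<close>

lemma card_admissible_ge:
  fixes c :: "nat \<Rightarrow> nat"
  assumes "inj c" and pos: "\<And>k. 0 < c k" and B: "B = range c"
    and cop: "\<And>j k. j \<noteq> k \<Longrightarrow> coprime (c j) (c k)"
    and "summable (\<lambda>k. 1 / real (c k))"
  shows "2 powr (real n * (\<Prod>k<K. 1 - 1 / real (c k)) - real (\<Prod>k<K. c k - 1)
      - real n * (\<Sum>k. 1 / real (c (k + K))))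
    \<le> real (card {A. A \<subseteq> {1..n} \<and> admissible_set B A})"
proof -
  let ?E = "{a \<in> {1..n}. \<forall>k. \<not> c k dvd a}"
  let ?EK = "{a \<in> {1..n}. \<forall>k\<in>{..<K}. a mod c k \<noteq> 0}"
  let ?T = "{a \<in> {1..n}. \<exists>k\<ge>K. c k dvd a}"
  \<comment> \<open>A number that survives the first \<open>K\<close> moduli either survives all of
    them or is a multiple of a tail modulus.\<close>
  have "?EK \<subseteq> ?E \<union> ?T"
    by (auto simp: mod_eq_0_iff_dvd) (metis lessThan_iff not_less)
  then have "card ?EK \<le> card (?E \<union> ?T)"
    by (intro card_mono) auto
  also have "\<dots> \<le> card ?E + card ?T" by (rule card_Un_le)
  finally have "real (card ?EK) \<le> real (card ?E) + real (card ?T)"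
    unfolding of_nat_add[symmetric] by (rule of_nat_mono)
  moreover have "real n * (\<Prod>k<K. 1 - 1 / real (c k)) - real (\<Prod>k<K. c k - 1) \<le> real (card ?EK)"
    using card_avoid_residues_bounds[of "{..<K}" "\<lambda>_. 0" c n] pos cop by (auto simp: abs_le_iff)
  moreover note card_tail_multiples_le[of c n K, OF assms(1) pos assms(5)]
  ultimately have "2 powr (real n * (\<Prod>k<K. 1 - 1 / real (c k)) - real (\<Prod>k<K. c k - 1)
      - real n * (\<Sum>k. 1 / real (c (k + K)))) \<le> 2 powr real (card ?E)"
    by (intro powr_mono) linarith+
  also have "\<dots> = real (card (Pow ?E))"
    by (simp add: card_Pow powr_realpow)
  also have "\<dots> \<le> real (card {A. A \<subseteq> {1..n} \<and> admissible_set B A})"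
  proof (intro of_nat_mono card_mono subsetI)
    fix A assume A: "A \<in> Pow ?E"
    have "residue_count A (c k) < c k" for k
      unfolding residue_count_less_iff[OF pos]
      using A pos[of k] by (intro exI[of _ 0]) (auto simp: dvd_eq_mod_eq_0)
    with A show "A \<in> {A. A \<subseteq> {1..n} \<and> admissible_set B A}"
      by (auto simp: admissible_set_def B)
  qed simp
  finally show ?thesis .
qed

section \<open>Passage to the limit\<close>

text \<open>Both counting bounds become additive after taking \<open>log 2\<close> and dividing by
  \<open>n\<close>. The first error term depends only on \<open>K\<close>; the second vanishes as
  \<open>n\<close> grows with \<open>K\<close> fixed.\<close>

lemma entropy_seq_bounds:
  fixes c :: "nat \<Rightarrow> nat"
  assumes "inj c" and pos: "\<And>k. 0 < c k" and B: "B = range c"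
    and cop: "\<And>j k. j \<noteq> k \<Longrightarrow> coprime (c j) (c k)"
    and "summable (\<lambda>k. 1 / real (c k))" and "0 < n"
  shows "\<bar>entropy_seq (admissible_shift B) n - (\<Prod>k<K. 1 - 1 / real (c k))\<bar>
    \<le> (\<Sum>k. 1 / real (c (k + K)))
      + (log 2 (real (\<Prod>k<K. c k)) + real (\<Prod>k<K. c k - 1)) / real n"
proof -
  define p where "p = (\<Prod>k<K. 1 - 1 / real (c k))"
  define t where "t = (\<Sum>k. 1 / real (c (k + K)))"
  define P where "P = (\<Prod>k<K. c k)"
  define Q where "Q = (\<Prod>k<K. c k - 1)"
  define G where "G = real (card (words (admissible_shift B) n))"
  have "0 \<notin> B" using pos unfolding B by (metis imageE less_numeral_extra(3))
  have G: "G = real (card {A. A \<subseteq> {1..n} \<and> admissible_set B A})"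
    unfolding G_def card_words_admissible_shift[OF \<open>0 \<notin> B\<close>] ..
  have upper: "G \<le> real P * 2 powr (real n * p + real Q)"
    unfolding G p_def P_def Q_def using pos cop by (intro card_admissible_le) (auto simp: B)
  have lower: "2 powr (real n * p - real Q - real n * t) \<le> G"
    unfolding G p_def t_def Q_def using assms by (intro card_admissible_ge)
  \<comment> \<open>Positivity, needed to apply the logarithm to the upper bound, comes from the
    lower one.\<close>
  have "0 < G" using lower less_le_trans powr_gt_zero by (metis zero_neq_numeral)
  have "1 \<le> P" unfolding P_def using pos by (simp add: prod_pos Suc_leI)
  then have "0 \<le> log 2 (real P)" by simp
  have "0 \<le> t"
    unfolding t_def using summable_ignore_initial_segment[OF assms(5), of K]
    by (intro suminf_nonneg) auto
  have "log 2 G \<le> log 2 (real P * 2 powr (real n * p + real Q))"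
    using upper \<open>0 < G\<close> by (intro log_mono) auto
  also have "\<dots> = log 2 (real P) + (real n * p + real Q)"
    using \<open>1 \<le> P\<close> by (simp add: log_mult)
  finally have u: "log 2 G - real n * p \<le> log 2 (real P) + real Q" by simp
  have "log 2 (2 powr (real n * p - real Q - real n * t)) \<le> log 2 G"
    using lower by (intro log_mono) auto
  then have l: "real n * p - real Q - real n * t \<le> log 2 G" by simp
  \<comment> \<open>The upper estimate has no tail term and the lower one no
    \<open>log 2 (real P)\<close>; as both terms are nonnegative, the sum of all errors serves for
    either side.\<close>
  have "0 \<le> real n * t" using \<open>0 \<le> t\<close> by simp
  with u l \<open>0 \<le> log 2 (real P)\<close>
  have "\<bar>log 2 G - real n * p\<bar> \<le> real n * t + (log 2 (real P) + real Q)"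
    by (simp add: abs_le_iff)
  then have "\<bar>log 2 G - real n * p\<bar> / real n \<le> (real n * t + (log 2 (real P) + real Q)) / real n"
    by (intro divide_right_mono) auto
  moreover have "\<bar>log 2 G - real n * p\<bar> / real n = \<bar>log 2 G / real n - p\<bar>"
    using \<open>0 < n\<close> by (simp add: field_simps flip: abs_div_pos)
  ultimately show ?thesis
    using \<open>0 < n\<close> unfolding entropy_seq_def p_def t_def P_def Q_def G_def
    by (simp add: add_divide_distrib)
qed

text \<open>\<open>C K\<close> may grow with \<open>K\<close>, so the order of choices matters:
  first fix \<open>K\<close> with \<open>p K\<close> near \<open>L\<close> and \<open>t K\<close>
  small, then take \<open>n\<close> large enough to absorb \<open>C K / real n\<close>.\<close>

lemma tendsto_if_approx:
  fixes e p t C :: "nat \<Rightarrow> real"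
  assumes bound: "\<And>K n. 0 < n \<Longrightarrow> \<bar>e n - p K\<bar> \<le> t K + C K / real n"
    and "p \<longlonglongrightarrow> L" and "t \<longlonglongrightarrow> 0"
  shows "e \<longlonglongrightarrow> L"
proof (rule LIMSEQ_I)
  fix \<epsilon> :: real assume "0 < \<epsilon>"
  then have "\<forall>\<^sub>F K in sequentially. dist (p K) L < \<epsilon> / 3 \<and> dist (t K) 0 < \<epsilon> / 3"
    using assms(2,3) by (intro eventually_conj tendstoD) auto
  then obtain K where K: "dist (p K) L < \<epsilon> / 3" "dist (t K) 0 < \<epsilon> / 3"
    using eventually_happens by fastforce
  have "(\<lambda>n. C K / real n) \<longlonglongrightarrow> 0" by (rule lim_const_over_n)
  then obtain N where N: "\<And>n. n \<ge> N \<Longrightarrow> \<bar>C K / real n\<bar> < \<epsilon> / 3"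
    using LIMSEQ_D[of _ 0 "\<epsilon> / 3"] \<open>0 < \<epsilon>\<close> by (metis diff_zero real_norm_def zero_less_divide_iff zero_less_numeral)
  \<comment> \<open>The maximum with 1 ensures \<open>0 < n\<close>, as \<open>bound\<close>
    requires.\<close>
  have "norm (e n - L) < \<epsilon>" if "n \<ge> max N 1" for n
    using bound[of n K] N[of n] K that unfolding dist_real_def real_norm_def by linarith
  then show "\<exists>N. \<forall>n\<ge>N. norm (e n - L) < \<epsilon>" by blast
qed

text \<open>The two convergence claims give the equation its content, since \<open>lim\<close> and
  the infinite product are unspecified values when no limit exists.\<close>

theorem theorem5p3:
  fixes B :: "nat set" and b :: "nat \<Rightarrow> nat"
  assumes "infinite B"
    and "B \<subseteq> {2..}"
    and "pairwise coprime B"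
    and "bij_betw b {1..} B"
    and "summable (\<lambda>k. 1 / real (b (Suc k)))"
  shows "convergent (entropy_seq (admissible_shift B)) \<and>
    convergent_prod (\<lambda>k. 1 - 1 / real (b (Suc k))) \<and>
    top_entropy (admissible_shift B) = (\<Prod>k. 1 - 1 / real (b (Suc k)))"
proof -
  \<comment> \<open>Reindexing from \<open>{1..}\<close> to all naturals: \<open>c 0\<close> is the
    first modulus \<open>b 1\<close>.\<close>
  define c where "c = (\<lambda>k. b (Suc k))"
  have "inj c"
    using bij_betw_imp_inj_on[OF assms(4)] by (auto simp: c_def inj_def inj_on_def)
  have "range c = b ` range Suc" by (auto simp: c_def)
  also have "range Suc = {1..}" by (auto simp: image_iff Suc_le_eq gr0_conv_Suc)
  finally have B: "B = range c" using bij_betw_imp_surj_on[OF assms(4)] by simp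
  have ge2: "2 \<le> c k" for k using assms(2) B by auto
  have pos: "0 < c k" for k using ge2[of k] by simp
  have cop: "coprime (c j) (c k)" if "j \<noteq> k" for j k
    using assms(3) \<open>inj c\<close> that unfolding B pairwise_def by (auto dest: injD)
  have summ: "summable (\<lambda>k. 1 / real (c k))" using assms(5) by (simp add: c_def)
  \<comment> \<open>The criterion for products of \<open>1 + z k\<close> asks for absolute
    summability and for no factor to vanish; the latter means \<open>c k \<noteq> 1\<close>.\<close>
  have "convergent_prod (\<lambda>k. 1 + - (1 / real (c k)))"
  proof (rule summable_imp_convergent_prod_real)
    show "summable (\<lambda>k. \<bar>- (1 / real (c k))\<bar>)" using summ by simp
    show "- (1 / real (c k)) \<noteq> -1" for k using ge2[of k] by simp
  qed
  then have conv: "convergent_prod (\<lambda>k. 1 - 1 / real (c k))" by simp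
  \<comment> \<open>\<open>convergent_prod_LIMSEQ\<close> concerns products over
    \<open>{..n}\<close>; passing to \<open>{..<K}\<close> shifts the index by one and keeps the
    limit.\<close>
  have "(\<lambda>K. \<Prod>k<K. 1 - 1 / real (c k)) \<longlonglongrightarrow> (\<Prod>k. 1 - 1 / real (c k))"
    using convergent_prod_LIMSEQ[OF conv] by (simp add: LIMSEQ_lessThan_iff_atMost)
  moreover have "(\<lambda>K. \<Sum>k. 1 / real (c (k + K))) \<longlonglongrightarrow> 0"
    by (rule suminf_exist_split2[OF summ])
  ultimately have "entropy_seq (admissible_shift B) \<longlonglongrightarrow> (\<Prod>k. 1 - 1 / real (c k))"
    by (intro tendsto_if_approx[OF entropy_seq_bounds[OF \<open>inj c\<close> pos B cop summ]])
  then show ?thesis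
    using conv limI unfolding top_entropy_def c_def by (auto simp: convergent_def)
qed

end
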